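(* Let $m=p_1^{r_1}\cdots p_k^{r_k}$ be an integer with $k\geq 1$, $p_1,\dots,p_k$ distinct primes and $r_1,\dots,r_k\geq 1$, and let $p$ be the maximal prime factor of $m$. Then $$M(m)=m(p),$$ unless $m=2^r\cdot 3$ for some integer $r\geq 2$, in which case $M(m)=2^{r-2}\cdot 3^2$.
   Context: For a polynomial $f\in\mathbb{Z}[X]$ and an integer $m\geq 1$, $(f\bmod m)$ denotes the function $\mathbb{Z}/m\mathbb{Z}\to\mathbb{Z}/m\mathbb{Z}$, $a\mapsto f(a)$, induced by $f$. Its value set (image) is $V(f\bmod m)\subseteq\mathbb{Z}/m\mathbb{Z}$, and $N(f,m)=\#V(f\bmod m)$. One says $(f\bmod m)$ is a permutation if this induced function is bijective, equivalently $N(f,m)=m$. Define $$M(m)=\max\{N(f,m)\ |\ f\in\mathbb{Z}[X],\ (f\bmod m)\text{ is not a permutation}\}.$$ For a prime factor $p$ of $m$, with $\mathrm{ord}_p(m)=\max\{i\geq 0\ |\ p^i\mid m\}$, define the number $$m(p)=\begin{cases}m\left(1-\frac{1}{p}\right), & \mathrm{ord}_p(m)=1,\\ m\left(1-\frac{1}{p}+\frac{1}{p^2}\right), & \mathrm{ord}_p(m)\geq 2.\end{cases}$$ *)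

theory Defs
  imports Complex_Main "HOL-Number_Theory.Number_Theory" "HOL-Computational_Algebra.Polynomial"
begin

text \<open>
  The ring of integers modulo \<open>m\<close> is \<^term>\<open>residue_ring (int m)\<close>; its elements are the
  representatives \<open>0, \<dots>, m - 1\<close> of the residue classes.
\<close>

abbreviation Zmod :: "nat \<Rightarrow> int set" where
  "Zmod m \<equiv> carrier (residue_ring (int m))"

definition poly_fun_mod :: "int poly \<Rightarrow> nat \<Rightarrow> int \<Rightarrow> int" where
  "poly_fun_mod f m = (\<lambda>a. poly f a mod int m)"

text \<open>The value depends only on the residue class of the argument.\<close>

lemma poly_fun_mod_cong:
  assumes "[a = b] (mod int m)"
  shows "poly_fun_mod f m a = poly_fun_mod f m b"
proof -
  have "[poly f a = poly f b] (mod int m)"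
    by (induction f) (auto intro!: cong_add cong_mult assms)
  then show ?thesis
    by (simp add: poly_fun_mod_def cong_def)
qed

definition value_set_mod :: "int poly \<Rightarrow> nat \<Rightarrow> int set" where
  "value_set_mod f m = poly_fun_mod f m ` Zmod m"

definition num_values_mod :: "int poly \<Rightarrow> nat \<Rightarrow> nat" where
  "num_values_mod f m = card (value_set_mod f m)"

definition is_permutation_mod :: "int poly \<Rightarrow> nat \<Rightarrow> bool" where
  "is_permutation_mod f m \<longleftrightarrow> bij_betw (poly_fun_mod f m) (Zmod m) (Zmod m)"

definition max_values_mod :: "nat \<Rightarrow> nat" where
  "max_values_mod m = Max {num_values_mod f m | f. \<not> is_permutation_mod f m}"

text \<open>The maximum is over a finite set, nonempty for \<open>m \<ge> 2\<close>, so \<^const>\<open>Max\<close> is meaningful.\<close>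

lemma finite_num_values_mod:
  assumes "m \<ge> 1"
  shows "finite {num_values_mod f m | f. \<not> is_permutation_mod f m}"
proof (rule finite_subset)
  have "card (value_set_mod f m) \<le> m" for f
    using card_image_le[of "{0..int m - 1}" "poly_fun_mod f m"]
    by (simp add: value_set_mod_def residue_ring_def)
  then show "{num_values_mod f m | f. \<not> is_permutation_mod f m} \<subseteq> {..m}"
    by (auto simp: num_values_mod_def)
qed simp

lemma nonempty_num_values_mod:
  assumes "m \<ge> 2"
  shows "{num_values_mod f m | f. \<not> is_permutation_mod f m} \<noteq> {}"
proof -
  have "poly_fun_mod 0 m 0 = poly_fun_mod 0 m 1" "0 \<in> Zmod m" "1 \<in> Zmod m"
    using assms by (auto simp: poly_fun_mod_def residue_ring_def)
  then have "\<not> inj_on (poly_fun_mod 0 m) (Zmod m)"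
    by (metis inj_onD zero_neq_one)
  then show ?thesis
    by (auto simp: is_permutation_mod_def bij_betw_def)
qed

text \<open>The number \<open>m(p)\<close>, only used for prime factors \<open>p\<close> of \<open>m\<close>, i.e. for
  \<open>multiplicity p m \<ge> 1\<close>.\<close>

definition m_of_prime :: "nat \<Rightarrow> nat \<Rightarrow> real" where
  "m_of_prime m p =
     (if multiplicity p m = 1 then real m * (1 - 1 / real p)
      else real m * (1 - 1 / real p + 1 / (real p)\<^sup>2))"

end

theory Submission imports Defs
begin

text \<open>
  By the Chinese remainder theorem \<open>N(f, m)\<close> is the product of the \<open>N(f, p ^ r)\<close> over the exact prime
  powers of \<open>m\<close>, and a non-permutation modulo \<open>m\<close> fails already modulo one of them; so \<open>M(m) / m\<close> is
  the maximum of \<open>M(p ^ r) / p ^ r\<close>. If \<open>f\<close> permutes the residues modulo \<open>p\<close> but not modulo \<open>p ^ r\<close>,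
  then by Hensel lifting \<open>f'\<close> vanishes modulo \<open>p\<close> at some \<open>a\<close>, so \<open>f\<close> is constant modulo \<open>p\<^sup>2\<close> on the
  class of \<open>a\<close>; this loses \<open>p - 1\<close> of the \<open>p\<^sup>2\<close> residues. Since \<open>1 - 1/p + 1/p\<^sup>2 \<le> 1 - 1/q\<close> as soon as
  \<open>q \<ge> p + 2\<close>, the largest prime wins except possibly for \<open>p = 2\<close>, \<open>q = 3\<close>.
\<close>

section \<open>Value sets and permutations in terms of integer congruences\<close>

lemma Zmod_eq: "m > 0 \<Longrightarrow> Zmod m = {0..<int m}"
  by (auto simp: residue_ring_def)

text \<open>Every integer reduces to a representative with the same value, so counting arguments may
  evaluate \<open>f\<close> at arbitrary integers.\<close>

lemma value_set_mod_eq_range: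
  assumes "m > 0"
  shows "value_set_mod f m = range (poly_fun_mod f m)"
proof -
  have "poly_fun_mod f m x \<in> poly_fun_mod f m ` {0..<int m}" for x
    using poly_fun_mod_cong[of x "x mod int m" m f] assms
    by (auto simp: cong_def)
  then show ?thesis
    using assms by (auto simp: value_set_mod_def Zmod_eq)
qed

lemma poly_fun_mod_eq_iff:
  "poly_fun_mod f m x = poly_fun_mod f m y \<longleftrightarrow> [poly f x = poly f y] (mod int m)"
  by (simp add: poly_fun_mod_def cong_def)

lemma range_poly_fun_mod_subset: "m > 0 \<Longrightarrow> poly_fun_mod f m ` A \<subseteq> {0..<int m}"
  by (auto simp: poly_fun_mod_def)

lemma finite_poly_fun_mod_image: "m > 0 \<Longrightarrow> finite (poly_fun_mod f m ` A)"
  by (rule finite_subset[OF range_poly_fun_mod_subset]) auto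

lemma is_permutation_mod_iff_inj_on:
  assumes "m > 0"
  shows "is_permutation_mod f m \<longleftrightarrow> inj_on (poly_fun_mod f m) {0..<int m}"
proof -
  have "poly_fun_mod f m ` {0..<int m} = {0..<int m}" if "inj_on (poly_fun_mod f m) {0..<int m}"
    using endo_inj_surj[OF _ range_poly_fun_mod_subset that] assms by simp
  then show ?thesis
    using assms by (auto simp: is_permutation_mod_def Zmod_eq bij_betw_def)
qed

text \<open>Frees injectivity from the chosen representatives: congruences between arbitrary
  integers can be passed to divisors of \<open>m\<close> and lifted back.\<close>

lemma is_permutation_mod_iff_cong:
  assumes "m > 0"
  shows "is_permutation_mod f m \<longleftrightarrow>
    (\<forall>x y. [poly f x = poly f y] (mod int m) \<longrightarrow> [x = y] (mod int m))" (is "_ \<longleftrightarrow> ?R")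
proof
  assume inj: "is_permutation_mod f m"
  show ?R
  proof (intro allI impI)
    fix x y assume "[poly f x = poly f y] (mod int m)"
    then have "poly_fun_mod f m (x mod int m) = poly_fun_mod f m (y mod int m)"
      by (metis cong_mod_left cong_refl poly_fun_mod_cong poly_fun_mod_eq_iff)
    with inj assms show "[x = y] (mod int m)"
      by (auto simp: is_permutation_mod_iff_inj_on cong_def inj_on_def)
  qed
next
  assume ?R
  then show "is_permutation_mod f m"
    using assms cong_less_imp_eq_int
    by (auto simp: is_permutation_mod_iff_inj_on inj_on_def poly_fun_mod_eq_iff)
qed

lemma num_values_mod_le:
  assumes "m > 0"
  shows "num_values_mod f m \<le> m"
  using card_mono[OF _ range_poly_fun_mod_subset[OF assms, of f UNIV]] assms
  by (simp add: num_values_mod_def value_set_mod_eq_range)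

lemma is_permutation_mod_iff_num_values:
  assumes "m > 0"
  shows "is_permutation_mod f m \<longleftrightarrow> num_values_mod f m = m"
  using assms
  by (auto simp: is_permutation_mod_iff_inj_on num_values_mod_def value_set_mod_def
      Zmod_eq card_image intro: eq_card_imp_inj_on)

lemma card_le_num_values_mod:
  assumes "m > 0" "inj_on (poly_fun_mod f m) A"
  shows "card A \<le> num_values_mod f m"
  using card_mono[OF finite_poly_fun_mod_image[of m f UNIV], of "poly_fun_mod f m ` A"] assms
  by (simp add: num_values_mod_def value_set_mod_eq_range card_image image_mono)

section \<open>Value counts for a product of moduli\<close>

text \<open>A residue modulo \<open>a\<close> has \<open>b\<close> lifts modulo
  \<open>a * b\<close>, so each value modulo \<open>a\<close> lies below at most \<open>b\<close>
  values. A proportion of values lost modulo \<open>a\<close> thus stays lost modulo every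
  multiple.\<close>

lemma num_values_mod_mult_le:
  assumes "a > 0" "b > 0"
  shows "num_values_mod f (a * b) \<le> num_values_mod f a * b"
proof -
  let ?W = "range (poly_fun_mod f a) \<times> {0..<int b}"
  have "range (poly_fun_mod f (a * b)) \<subseteq> (\<lambda>(v, j). v + int a * j) ` ?W"
  proof
    fix w assume "w \<in> range (poly_fun_mod f (a * b))"
    then obtain x where w: "w = poly f x mod (int a * int b)"
      by (auto simp: poly_fun_mod_def)
    have "w = poly f x mod int a + int a * (poly f x div int a mod int b)"
      by (simp add: w zmod_zmult2_eq)
    then show "w \<in> (\<lambda>(v, j). v + int a * j) ` ?W"
      using assms by (intro image_eqI[of _ _ "(poly f x mod int a, poly f x div int a mod int b)"])
        (auto simp: poly_fun_mod_def)
  qed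
  moreover have "finite ?W"
    using assms finite_poly_fun_mod_image by auto
  ultimately have "card (range (poly_fun_mod f (a * b))) \<le> card ?W"
    by (meson card_image_le card_mono finite_imageI order_trans)
  then show ?thesis
    using assms by (simp add: num_values_mod_def value_set_mod_eq_range card_cartesian_product)
qed

text \<open>By the Chinese remainder theorem one argument realises any prescribed pair of values
  modulo \<open>a\<close> and \<open>b\<close>.\<close>

lemma num_values_mod_mult_coprime:
  assumes "a > 0" "b > 0" "coprime a b"
  shows "num_values_mod f (a * b) \<ge> num_values_mod f a * num_values_mod f b"
proof -
  let ?h = "\<lambda>v. (v mod int a, v mod int b)"
  have "range (poly_fun_mod f a) \<times> range (poly_fun_mod f b) \<subseteq> ?h ` range (poly_fun_mod f (a * b))"
  proof clarify
    fix x y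
    obtain z where z: "[z = x] (mod int a)" "[z = y] (mod int b)"
      using binary_chinese_remainder_int[of "int a" "int b" x y] assms by auto
    then have "?h (poly_fun_mod f (a * b) z) = (poly_fun_mod f a x, poly_fun_mod f b y)"
      using poly_fun_mod_cong[of z x a f] poly_fun_mod_cong[of z y b f]
      by (simp add: poly_fun_mod_def mod_mod_cancel)
    then show "(poly_fun_mod f a x, poly_fun_mod f b y) \<in> ?h ` range (poly_fun_mod f (a * b))"
      by (intro image_eqI[OF sym rangeI])
  qed
  moreover have "finite (range (poly_fun_mod f (a * b)))"
    using assms finite_poly_fun_mod_image by simp
  ultimately have "card (range (poly_fun_mod f a) \<times> range (poly_fun_mod f b))
      \<le> card (range (poly_fun_mod f (a * b)))"
    by (rule surj_card_le[rotated])
  then show ?thesis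
    using assms by (simp add: num_values_mod_def value_set_mod_eq_range card_cartesian_product)
qed

lemma num_values_mod_cong:
  assumes "\<And>x. [poly f x = poly g x] (mod int m)"
  shows "num_values_mod f m = num_values_mod g m"
proof -
  have "poly_fun_mod f m = poly_fun_mod g m"
    using assms by (auto simp: poly_fun_mod_def cong_def)
  then show ?thesis
    by (simp add: num_values_mod_def value_set_mod_def)
qed

section \<open>Hensel lifting and the upper bound at prime powers\<close>

lemma poly_taylor1:
  fixes f :: "'a :: idom poly"
  shows "\<exists>c. poly f b = poly f a + (b - a) * (poly (pderiv f) a + (b - a) * c)"
proof (induction f)
  case (pCons u f)
  then obtain c where c: "poly f b = poly f a + (b - a) * (poly (pderiv f) a + (b - a) * c)"
    by blast
  \<comment> \<open>The derivative of \<open>u + X f\<close> is \<open>f + X f'\<close>; collecting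
    powers of \<open>b - a\<close> turns the old remainder \<open>c\<close> into
    \<open>f'(a) + b c\<close>.\<close>
  have "poly (pCons u f) b = poly (pCons u f) a
      + (b - a) * (poly (pderiv (pCons u f)) a + (b - a) * (poly (pderiv f) a + b * c))"
    by (simp add: c pderiv_pCons) (simp add: algebra_simps)
  then show ?case by blast
qed (simp add: exI[of _ 0])

text \<open>Uniqueness in Hensel's lemma: in the Taylor formula \<open>f(b) - f(a)\<close> is
  \<open>b - a\<close> times a factor congruent to \<open>f'(a)\<close> modulo \<open>p\<close>,
  hence prime to \<open>p ^ k\<close>.\<close>

lemma cong_prime_power_lift:
  fixes p :: nat and f :: "int poly"
  assumes "prime p" "[a = b] (mod int p)" "\<not> int p dvd poly (pderiv f) a"
    and "[poly f a = poly f b] (mod int (p ^ k))"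
  shows "[a = b] (mod int (p ^ k))"
proof -
  obtain c where c: "poly f b = poly f a + (b - a) * (poly (pderiv f) a + (b - a) * c)"
    using poly_taylor1 by blast
  have "int p dvd (b - a) * c"
    using assms(2) by (simp add: cong_iff_dvd_diff dvd_diff_commute)
  then have "\<not> int p dvd poly (pderiv f) a + (b - a) * c"
    using assms(3) by (simp add: dvd_add_left_iff)
  then have "coprime (int (p ^ k)) (poly (pderiv f) a + (b - a) * c)"
    using assms(1) by (simp add: prime_imp_coprime)
  moreover have "int (p ^ k) dvd (b - a) * (poly (pderiv f) a + (b - a) * c)"
    using assms(4) c by (simp add: cong_iff_dvd_diff dvd_diff_commute)
  ultimately show ?thesis
    by (metis cong_iff_dvd_diff coprime_dvd_mult_left_iff cong_sym)
qed

text \<open>For \<open>x\<close> in the class of \<open>a\<close> modulo \<open>p\<close>, both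
  \<open>x - a\<close> and its Taylor cofactor are divisible by \<open>p\<close>, so
  \<open>f(x)\<close> and \<open>f(a)\<close> agree modulo \<open>p\<^sup>2\<close>. The
  \<open>p\<close> residues in this class, called \<open>?C\<close>, share one value.\<close>

lemma num_values_mod_prime_square_le:
  fixes p :: nat
  assumes "prime p" "int p dvd poly (pderiv f) a"
  shows "num_values_mod f (p\<^sup>2) \<le> p\<^sup>2 - p + 1"
proof -
  let ?F = "poly_fun_mod f (p\<^sup>2)"
  let ?C = "(\<lambda>j. a mod int p + int p * j) ` {0..<int p}"
  have p: "p > 0"
    using assms(1) prime_gt_0_nat by blast
  have const: "?F x = ?F a" if "x \<in> ?C" for x
  proof -
    have "int p dvd x - a"
      using that by (auto simp: algebra_simps mod_eq_dvd_iff[symmetric])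
    moreover obtain c where "poly f x = poly f a + (x - a) * (poly (pderiv f) a + (x - a) * c)"
      using poly_taylor1 by blast
    ultimately have "int p * int p dvd poly f x - poly f a"
      using assms(2) by (auto intro!: mult_dvd_mono)
    then show ?thesis
      by (simp add: poly_fun_mod_eq_iff cong_iff_dvd_diff power2_eq_square)
  qed
  have sub: "?C \<subseteq> {0..<int (p\<^sup>2)}"
  proof clarify
    fix j assume j: "j \<in> {0..<int p}"
    then have "int p * j \<le> int p * (int p - 1)" "0 \<le> int p * j"
      by (auto intro!: mult_left_mono)
    moreover have "a mod int p < int p" "a mod int p \<ge> 0"
      using p by auto
    ultimately show "a mod int p + int p * j \<in> {0..<int (p\<^sup>2)}"
      by (simp add: power2_eq_square algebra_simps)
  qed
  have "card ?C = p"
    using p by (subst card_image) (auto simp: inj_on_def)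
  then have "card ({0..<int (p\<^sup>2)} - ?C) = p\<^sup>2 - p"
    by (subst card_Diff_subset[OF _ sub]) (auto simp: nat_power_eq)
  moreover have "value_set_mod f (p\<^sup>2) \<subseteq> insert (?F a) (?F ` ({0..<int (p\<^sup>2)} - ?C))"
    unfolding value_set_mod_def using p const Zmod_eq[of "p\<^sup>2"] by auto
  ultimately have "num_values_mod f (p\<^sup>2) \<le> card (insert (?F a) (?F ` ({0..<int (p\<^sup>2)} - ?C)))"
    unfolding num_values_mod_def by (intro card_mono) auto
  also have "\<dots> \<le> Suc (card ({0..<int (p\<^sup>2)} - ?C))"
    by (subst card_insert_if) (auto intro: card_image_le le_SucI)
  finally show ?thesis
    using \<open>card ({0..<int (p\<^sup>2)} - ?C) = p\<^sup>2 - p\<close> by simp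
qed

lemma power_eq_square_mult: "r \<ge> 2 \<Longrightarrow> x ^ r = x\<^sup>2 * x ^ (r - 2)" for x :: "'a :: monoid_mult"
  by (metis le_add_diff_inverse power_add)

text \<open>The value of \<open>M(p ^ r)\<close>, written without fractions so that it can be
  compared with cardinalities in \<open>nat\<close>.\<close>

definition prime_power_max :: "nat \<Rightarrow> nat \<Rightarrow> nat" where
  "prime_power_max p r = (if r = 1 then p - 1 else (p\<^sup>2 - p + 1) * p ^ (r - 2))"

text \<open>If \<open>f\<close> fails to be a permutation modulo \<open>p\<close>, it already misses
  one of \<open>p\<close> values there. Otherwise \<open>f'\<close> has a zero modulo
  \<open>p\<close>, since without one injectivity would lift from \<open>p\<close> to
  \<open>p ^ r\<close>, and the bound modulo \<open>p\<^sup>2\<close> applies.\<close>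

lemma num_values_mod_prime_power_le:
  assumes "prime p" "r \<ge> 1" "\<not> is_permutation_mod f (p ^ r)"
  shows "num_values_mod f (p ^ r) \<le> prime_power_max p r"
proof (cases "is_permutation_mod f p")
  case False
  have p: "p > 0"
    using assms(1) prime_gt_0_nat by blast
  have "num_values_mod f p \<le> p - 1"
    using False p num_values_mod_le[of p f] is_permutation_mod_iff_num_values[of p f] by linarith
  moreover have pr: "p ^ r = p * p ^ (r - 1)"
    using assms(2) by (simp flip: power_Suc)
  ultimately have le: "num_values_mod f (p ^ r) \<le> (p - 1) * p ^ (r - 1)"
    using num_values_mod_mult_le[of p "p ^ (r - 1)" f] p
    by (metis mult_le_mono1 order_trans zero_less_power)
  show ?thesis
  proof (cases "r = 1")
    case False
    with assms(2) have "r - 1 = Suc (r - 2)" by simp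
    \<comment> \<open>This branch stays below the bound by \<open>p ^ (r - 2)\<close>.\<close>
    then have "(p - 1) * p ^ (r - 1) = (p\<^sup>2 - p) * p ^ (r - 2)"
      by (simp add: power2_eq_square diff_mult_distrib)
    with le False show ?thesis
      by (simp add: prime_power_max_def)
  qed (use le in \<open>simp add: prime_power_max_def\<close>)
next
  case True
  have p: "p > 0"
    using assms(1) prime_gt_0_nat by blast
  have r: "r \<ge> 2"
    using True assms(2,3) by (cases "r = 1") auto
  obtain a where a: "int p dvd poly (pderiv f) a"
  proof (rule ccontr)
    assume *: "\<not> thesis"
    have "is_permutation_mod f (p ^ r)"
      unfolding is_permutation_mod_iff_cong[OF zero_less_power[OF p]]
    proof (intro allI impI)
      fix x y assume xy: "[poly f x = poly f y] (mod int (p ^ r))"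
      have "int p dvd int (p ^ r)"
        using assms(2) by simp
      with xy have "[poly f x = poly f y] (mod int p)"
        by (rule cong_dvd_modulus)
      with True p have "[x = y] (mod int p)"
        by (simp add: is_permutation_mod_iff_cong)
      then show "[x = y] (mod int (p ^ r))"
        using cong_prime_power_lift[OF assms(1) _ _ xy] * that by blast
    qed
    with assms(3) show False by blast
  qed
  have "num_values_mod f (p ^ r) \<le> num_values_mod f (p\<^sup>2) * p ^ (r - 2)"
    using num_values_mod_mult_le[of "p\<^sup>2" "p ^ (r - 2)" f] p power_eq_square_mult[OF r, of p] by simp
  also have "\<dots> \<le> (p\<^sup>2 - p + 1) * p ^ (r - 2)"
    by (intro mult_le_mono1 num_values_mod_prime_square_le[OF assms(1) a])
  finally show ?thesis
    using r by (simp add: prime_power_max_def)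
qed

section \<open>Polynomials attaining the bound at prime powers\<close>

lemma fermat_theorem_int:
  fixes p :: nat and a :: int
  assumes "prime p" "\<not> int p dvd a"
  shows "[a ^ (p - 1) = 1] (mod int p)"
proof -
  have "coprime (int p) a"
    using assms by (simp add: prime_imp_coprime)
  moreover have "residues (int p)"
    using prime_gt_1_nat[OF assms(1)] by unfold_locales simp
  ultimately show ?thesis
    using residues.euler_theorem[of "int p" a] assms(1)
    by (simp add: totient_prime coprime_commute)
qed

text \<open>The witness \<open>1 + X - X ^ (p - 1)\<close> fixes every nonzero residue by Fermat and
  sends 0 to 1, so 0 and 1 collide and nothing else is lost.\<close>

lemma exists_polynomial_prime_values:
  assumes "prime p"
  shows "\<exists>f. \<not> is_permutation_mod f p \<and> num_values_mod f p \<ge> p - 1"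
proof -
  define f :: "int poly" where "f = [:1, 1:] - monom 1 (p - 1)"
  have p: "p > 1"
    using assms prime_gt_1_nat by blast
  have f: "[poly f a = a] (mod int p)" if "\<not> int p dvd a" for a
    using fermat_theorem_int[OF assms that]
    by (simp add: f_def poly_monom cong_iff_dvd_diff dvd_diff_commute)
  have "inj_on (poly_fun_mod f p) {1..<int p}"
  proof (rule inj_onI)
    fix x y assume xy: "x \<in> {1..<int p}" "y \<in> {1..<int p}" "poly_fun_mod f p x = poly_fun_mod f p y"
    then have "\<not> int p dvd x" "\<not> int p dvd y"
      by (auto simp: zdvd_not_zless)
    with xy(3) f have "[x = y] (mod int p)"
      by (metis cong_sym cong_trans poly_fun_mod_eq_iff)
    with xy show "x = y"
      by (auto intro: cong_less_imp_eq_int)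
  qed
  from card_le_num_values_mod[OF _ this] have "num_values_mod f p \<ge> p - 1"
    using p by simp
  moreover have "\<not> is_permutation_mod f p"
  proof
    assume "is_permutation_mod f p"
    moreover have "[poly f 0 = poly f 1] (mod int p)"
      using p by (simp add: f_def poly_monom power_0_left)
    ultimately have "[0 = 1] (mod int p)"
      using p by (simp only: is_permutation_mod_iff_cong)
    then show False
      using p by (simp add: cong_iff_dvd_diff)
  qed
  ultimately show ?thesis by blast
qed

text \<open>The witness \<open>p X + X ^ (2 p - 1)\<close> is the identity modulo \<open>p\<close> with derivative vanishing modulo
  \<open>p\<close> only on the class of \<open>0\<close>, and on that class \<open>p t \<mapsto> p\<^sup>2 (t + p ^ (2 p - 3) t ^ (2 p - 1))\<close>, where
  the second factor permutes the residues modulo \<open>p ^ (r - 2)\<close>.\<close>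

lemma exists_polynomial_prime_power_values:
  assumes "prime p" "r \<ge> 2"
  shows "\<exists>f. \<not> is_permutation_mod f (p ^ r) \<and>
    num_values_mod f (p ^ r) \<ge> (p\<^sup>2 - p + 1) * p ^ (r - 2)"
proof -
  define f :: "int poly" where "f = [:0, int p:] + monom 1 (2 * p - 1)"
  define g :: "int poly" where "g = [:0, 1:] + monom (int p ^ (2 * p - 3)) (2 * p - 1)"
  \<comment> \<open>\<open>U\<close> consists of the residues prime to \<open>p\<close>. A multiple
    \<open>p * t\<close> has value \<open>p\<^sup>2 * g(t)\<close>, which depends only on
    \<open>t\<close> modulo \<open>p ^ (r - 2)\<close>; hence the range of \<open>T\<close>.\<close>
  define T where "T = {0..<int (p ^ (r - 2))}"
  define U where "U = {0..<int (p ^ r)} - (\<lambda>t. int p * t) ` {0..<int (p ^ (r - 1))}"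
  have p: "p \<ge> 2"
    using assms(1) prime_ge_2_nat by blast
  \<comment> \<open>The exponent is 1 modulo \<open>p - 1\<close>, so Fermat gives
    \<open>x ^ (2 * p - 1) = x\<close> modulo \<open>p\<close>. It is also -1 modulo
    \<open>p\<close>, which keeps \<open>f'\<close> nonzero at units; the exponent \<open>p\<close>
    would not. Since \<open>2 * p - 3\<close> is positive, \<open>g\<close> is the identity modulo
    \<open>p\<close>.\<close>
  then have exps: "2 * p - 1 = Suc ((p - 1) + (p - 1))" "2 * p - 1 = Suc (Suc (2 * p - 3))"
      "2 * p - 3 = Suc (2 * p - 4)"
    by linarith+
  have pr: "p ^ r = p * p ^ (r - 1)" "p ^ r = p\<^sup>2 * p ^ (r - 2)"
    using assms(2) by (simp add: power_eq_if) (rule power_eq_square_mult[OF assms(2)])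
  have U: "0 \<le> x" "x < int (p ^ r)" "\<not> int p dvd x" if "x \<in> U" for x
  proof -
    show x: "0 \<le> x" "x < int (p ^ r)"
      using that by (auto simp: U_def)
    show "\<not> int p dvd x"
    proof
      assume "int p dvd x"
      then obtain t where t: "x = int p * t" by blast
      with x p have "0 \<le> t" "int p * t < int p * int (p ^ (r - 1))"
        by (auto simp: pr(1) zero_le_mult_iff)
      with that t show False
        using p by (auto simp: U_def)
    qed
  qed
  have f_unit: "[poly f a = a] (mod int p)" if "\<not> int p dvd a" for a
  proof -
    have "[a * (a ^ (p - 1) * a ^ (p - 1)) = a * (1 * 1)] (mod int p)"
      by (intro cong_mult cong_refl fermat_theorem_int assms that)
    then have "[int p * a + a * (a ^ (p - 1) * a ^ (p - 1)) = 0 + a * (1 * 1)] (mod int p)"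
      by (intro cong_add) (auto simp: cong_0_iff)
    moreover have "poly f a = int p * a + a * (a ^ (p - 1) * a ^ (p - 1))"
      unfolding f_def exps(1) by (simp add: poly_monom power_add)
    ultimately show ?thesis
      by simp
  qed
  have f'_unit: "\<not> int p dvd poly (pderiv f) a" if "\<not> int p dvd a" for a
  proof
    assume "int p dvd poly (pderiv f) a"
    moreover have "poly (pderiv f) a = int p + int (2 * p - 1) * a ^ (2 * p - 2)"
      by (simp add: f_def pderiv_add pderiv_pCons pderiv_monom poly_monom numeral_2_eq_2)
    ultimately have "int p dvd int (2 * p - 1) * a ^ (2 * p - 2)"
      by simp
    then have "int p dvd int (2 * p - 1)"
      using that assms(1) by (metis prime_dvd_mult_iff prime_dvd_power prime_nat_int_transfer)
    then have "p dvd 2 * p - 1"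
      by (simp only: of_nat_dvd_iff)
    then have "p dvd 2 * p - (2 * p - 1)"
      by (rule dvd_diff_nat[OF dvd_triv_right])
    then show False
      using p by simp
  qed
  have f_mult: "poly f (int p * t) = int (p\<^sup>2) * poly g t" for t
    unfolding f_def g_def exps(2)
    by (simp add: poly_monom power_mult_distrib algebra_simps power2_eq_square)
  have g_cong: "[poly g t = t] (mod int p)" for t
    by (simp add: g_def poly_monom cong_iff_dvd_diff exps(3))
  have g': "\<not> int p dvd poly (pderiv g) t" for t
  proof
    assume "int p dvd poly (pderiv g) t"
    moreover have "poly (pderiv g) t = 1 + int p * (int p ^ (2 * p - 4) * int (2 * p - 1) * t ^ (2 * p - 2))"
      unfolding g_def exps(3)
      by (simp add: pderiv_add pderiv_pCons pderiv_monom poly_monom numeral_2_eq_2)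
    ultimately show False
      using p by (simp add: dvd_add_left_iff)
  qed
  have g_inj: "[s = t] (mod int (p ^ k))" if "[poly g s = poly g t] (mod int (p ^ k))" for s t k
  proof (cases "k = 0")
    case False
    then have "int p dvd int (p ^ k)" by simp
    with that have "[poly g s = poly g t] (mod int p)"
      by (rule cong_dvd_modulus)
    then have "[s = t] (mod int p)"
      using g_cong by (metis cong_sym cong_trans)
    then show ?thesis
      by (rule cong_prime_power_lift[OF assms(1) _ g' that])
  qed simp
  have inj_U: "inj_on (poly_fun_mod f (p ^ r)) U"
  proof (rule inj_onI)
    fix x y assume xy: "x \<in> U" "y \<in> U" "poly_fun_mod f (p ^ r) x = poly_fun_mod f (p ^ r) y"
    then have *: "[poly f x = poly f y] (mod int (p ^ r))"
      by (simp add: poly_fun_mod_eq_iff)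
    moreover have "int p dvd int (p ^ r)"
      using pr(1) by simp
    ultimately have "[poly f x = poly f y] (mod int p)"
      by (rule cong_dvd_modulus)
    then have "[x = y] (mod int p)"
      using f_unit U(3) xy by (metis cong_sym cong_trans)
    then have "[x = y] (mod int (p ^ r))"
      using cong_prime_power_lift[OF assms(1) _ f'_unit *] U(3) xy by blast
    then show "x = y"
      using U xy by (auto intro: cong_less_imp_eq_int)
  qed
  have inj_T: "inj_on (poly_fun_mod f (p ^ r)) ((\<lambda>t. int p * t) ` T)"
  proof (rule inj_onI, clarify)
    fix s t assume st: "s \<in> T" "t \<in> T"
      "poly_fun_mod f (p ^ r) (int p * s) = poly_fun_mod f (p ^ r) (int p * t)"
    then have "int (p\<^sup>2) * int (p ^ (r - 2)) dvd int (p\<^sup>2) * (poly g s - poly g t)"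
      by (simp only: poly_fun_mod_eq_iff cong_iff_dvd_diff f_mult pr(2) right_diff_distrib of_nat_mult)
    then have "int (p ^ (r - 2)) dvd poly g s - poly g t"
      using p by simp
    then have "[s = t] (mod int (p ^ (r - 2)))"
      using g_inj by (simp only: cong_iff_dvd_diff)
    then show "int p * s = int p * t"
      using st by (auto simp: T_def intro: cong_less_imp_eq_int)
  qed
  have disj: "poly_fun_mod f (p ^ r) x \<noteq> poly_fun_mod f (p ^ r) (int p * t)" if "x \<in> U" for x t
  proof
    assume "poly_fun_mod f (p ^ r) x = poly_fun_mod f (p ^ r) (int p * t)"
    then have "[poly f x = poly f (int p * t)] (mod int (p ^ r))"
      by (simp add: poly_fun_mod_eq_iff)
    moreover have "int p dvd int (p ^ r)"
      using pr(1) by simp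
    ultimately have "[poly f x = poly f (int p * t)] (mod int p)"
      by (rule cong_dvd_modulus)
    \<comment> \<open>Modulo \<open>p\<close>, units are fixed while multiples of \<open>p\<close>
      go to 0.\<close>
    then have "[x = int (p\<^sup>2) * poly g t] (mod int p)"
      using f_unit[OF U(3)[OF that]] f_mult by (metis cong_sym cong_trans)
    moreover have "int p dvd int (p\<^sup>2) * poly g t"
      by (simp add: power2_eq_square)
    ultimately show False
      using U(3)[OF that] cong_dvd_iff by blast
  qed
  have "inj_on (poly_fun_mod f (p ^ r)) (U \<union> (\<lambda>t. int p * t) ` T)"
    using inj_U inj_T disj by (auto simp: inj_on_Un)
  then have le: "card (U \<union> (\<lambda>t. int p * t) ` T) \<le> num_values_mod f (p ^ r)"
    using p by (intro card_le_num_values_mod) auto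
  have inj_p: "inj_on (\<lambda>t. int p * t) A" for A
    using p by (auto simp: inj_on_def)
  have "(\<lambda>t. int p * t) ` {0..<int (p ^ (r - 1))} \<subseteq> {0..<int (p ^ r)}"
    using p by (auto simp: pr(1))
  then have "card U = p ^ r - p ^ (r - 1)"
    unfolding U_def using p
    by (subst card_Diff_subset) (auto simp: card_image[OF inj_p] nat_power_eq)
  moreover have "card ((\<lambda>t. int p * t) ` T) = p ^ (r - 2)"
    by (simp add: card_image[OF inj_p] T_def nat_power_eq)
  moreover have "U \<inter> (\<lambda>t. int p * t) ` T = {}"
    using disj by blast
  moreover have "finite U" "finite T"
    by (auto simp: U_def T_def)
  ultimately have "card (U \<union> (\<lambda>t. int p * t) ` T) = p ^ r - p ^ (r - 1) + p ^ (r - 2)"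
    by (simp add: card_Un_disjoint)
  also have "p ^ (r - 1) = p * p ^ (r - 2)"
    using trans[OF pr(1)[symmetric] pr(2)] p by (simp add: power2_eq_square mult.assoc)
  also have "p ^ r - p * p ^ (r - 2) + p ^ (r - 2) = (p\<^sup>2 - p + 1) * p ^ (r - 2)"
    by (simp add: pr(2) diff_mult_distrib add_mult_distrib)
  finally have "num_values_mod f (p ^ r) \<ge> (p\<^sup>2 - p + 1) * p ^ (r - 2)"
    using le by simp
  moreover have "\<not> is_permutation_mod f (p ^ r)"
  proof
    assume perm: "is_permutation_mod f (p ^ r)"
    \<comment> \<open>The arguments \<open>p ^ (r - 1)\<close> and 0 collide: the linear term at
      \<open>p ^ (r - 1)\<close> is exactly \<open>p ^ r\<close>, and the other has exponent at
      least \<open>2 * (r - 1)\<close>, which is at least \<open>r\<close>.\<close>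
    have "2 * p - 1 \<ge> 2" using p by simp
    then have "r \<le> (r - 1) * 2" "(r - 1) * 2 \<le> (r - 1) * (2 * p - 1)"
      using assms(2) by auto
    then have "int p ^ r dvd int p ^ ((r - 1) * (2 * p - 1))"
      by (intro le_imp_power_dvd) linarith
    then have "[poly f (int p ^ (r - 1)) = poly f 0] (mod int (p ^ r))"
      using assms(2) p by (simp add: f_def poly_monom cong_0_iff power_mult power_0_left)
        (simp add: pr(1) flip: of_nat_power)
    with perm have "[int p ^ (r - 1) = 0] (mod int (p ^ r))"
      using p by (simp add: is_permutation_mod_iff_cong)
    then have "p ^ r dvd p ^ (r - 1)"
      by (simp add: cong_0_iff flip: of_nat_power)
    then show False
      using p assms(2) by (auto dest!: power_dvd_imp_le)
  qed
  ultimately show ?thesis by blast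
qed

lemma exists_polynomial_prime_power_max:
  assumes "prime p" "r \<ge> 1"
  shows "\<exists>f. \<not> is_permutation_mod f (p ^ r) \<and> num_values_mod f (p ^ r) \<ge> prime_power_max p r"
  using exists_polynomial_prime_values[of p] exists_polynomial_prime_power_values[of p r] assms
  by (cases "r = 1") (auto simp: prime_power_max_def)

section \<open>From prime powers to a general modulus\<close>

lemma m_of_prime_eq_prime_power_max:
  assumes "prime p" "r \<ge> 1" "\<not> p dvd n"
  shows "m_of_prime (p ^ r * n) p = real (prime_power_max p r * n)"
proof -
  have p: "p \<ge> 1" "p \<noteq> 0"
    using prime_gt_0_nat[OF assms(1)] by simp_all
  have n: "n \<noteq> 0"
    using assms(3) by (intro notI) simp
  have mult: "multiplicity p (p ^ r * n) = r"
    using assms by (intro multiplicity_eqI) (auto simp: p)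
  show ?thesis
  proof (cases "r = 1")
    case True
    then show ?thesis
      using mult p by (simp add: m_of_prime_def prime_power_max_def of_nat_diff field_simps)
  next
    case False
    with assms(2) have "2 \<le> r" by simp
    then have "p ^ r = p\<^sup>2 * p ^ (r - 2)"
      by (rule power_eq_square_mult)
    moreover have "p \<le> p\<^sup>2"
      by (simp add: power2_eq_square)
    ultimately show ?thesis
      using False mult p
      by (simp add: m_of_prime_def prime_power_max_def of_nat_diff field_simps power2_eq_square)
  qed
qed

text \<open>Injectivity modulo all exact prime powers of \<open>m\<close> would give injectivity
  modulo \<open>m\<close>, so it fails at some \<open>p ^ r\<close>; the cofactor \<open>n\<close>
  contributes at most a factor \<open>n\<close>.\<close>

lemma num_values_mod_le_m_of_prime:
  assumes "m > 0" "\<not> is_permutation_mod f m"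
  shows "\<exists>p\<in>prime_factors m. real (num_values_mod f m) \<le> m_of_prime m p"
proof -
  have "\<exists>p\<in>prime_factors m. \<not> is_permutation_mod f (p ^ multiplicity p m)"
  proof (rule ccontr)
    assume "\<not> (\<exists>p\<in>prime_factors m. \<not> is_permutation_mod f (p ^ multiplicity p m))"
    then have perm: "is_permutation_mod f (p ^ multiplicity p m)" if "p \<in> prime_factors m" for p
      using that by blast
    have "[x = y] (mod int m)" if xy: "[poly f x = poly f y] (mod int m)" for x y
    proof (cases "x = y")
      case False
      \<comment> \<open>Divisibility of \<open>x - y\<close> by \<open>m\<close> is tested prime by
        prime. The case \<open>x = y\<close> is set apart because multiplicities in 0 default to
        0.\<close>
      have "multiplicity p m \<le> multiplicity p (nat \<bar>x - y\<bar>)" if p: "prime p" for p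
      proof (cases "p dvd m")
        case True
        have "int (p ^ multiplicity p m) dvd int m"
          by (simp only: of_nat_dvd_iff multiplicity_dvd)
        with xy have "[poly f x = poly f y] (mod int (p ^ multiplicity p m))"
          by (rule cong_dvd_modulus)
        moreover have "p ^ multiplicity p m > 0"
          using p prime_gt_0_nat by simp
        ultimately have "int (p ^ multiplicity p m) dvd x - y"
          using perm[of p] True p assms(1)
          by (simp only: is_permutation_mod_iff_cong cong_iff_dvd_diff prime_factors_dvd mem_Collect_eq)
        then have "p ^ multiplicity p m dvd nat \<bar>x - y\<bar>"
          by (simp flip: of_nat_dvd_iff)
        then show ?thesis
          using False p by (intro multiplicity_geI) auto
      qed (simp add: not_dvd_imp_multiplicity_0)
      then have "m dvd nat \<bar>x - y\<bar>"
        using assms(1) by (intro multiplicity_le_imp_dvd) auto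
      then have "int m dvd int (nat \<bar>x - y\<bar>)"
        by (simp only: of_nat_dvd_iff)
      then show ?thesis
        by (simp add: cong_iff_dvd_diff)
    qed simp
    with assms show False
      by (simp add: is_permutation_mod_iff_cong)
  qed
  then obtain p where p: "p \<in> prime_factors m" "\<not> is_permutation_mod f (p ^ multiplicity p m)"
    by blast
  define r where "r = multiplicity p m"
  have "prime p" "r \<ge> 1"
    using p(1) by (auto simp: r_def prime_factors_multiplicity)
  then obtain n where n: "m = p ^ r * n" "\<not> p dvd n"
    unfolding r_def using multiplicity_decompose'[of m p] assms(1)
    by (metis not_prime_unit neq0_conv)
  then have "n > 0"
    by (intro Nat.gr0I) simp
  then have "num_values_mod f m \<le> num_values_mod f (p ^ r) * n"
    using num_values_mod_mult_le[of "p ^ r" n f] \<open>prime p\<close> by (simp add: n(1) prime_gt_0_nat)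
  also have "\<dots> \<le> prime_power_max p r * n"
    using num_values_mod_prime_power_le[OF \<open>prime p\<close> \<open>r \<ge> 1\<close>] p(2) by (simp add: r_def)
  finally have "real (num_values_mod f m) \<le> m_of_prime m p"
    unfolding n(1) m_of_prime_eq_prime_power_max[OF \<open>prime p\<close> \<open>r \<ge> 1\<close> n(2)] of_nat_le_iff .
  with p(1) show ?thesis by blast
qed

text \<open>A prime power witness is glued to the identity modulo the cofactor \<open>n\<close>, so
  all loss occurs at \<open>p\<close>.\<close>

lemma exists_polynomial_m_of_prime:
  assumes "p \<in> prime_factors m"
  shows "\<exists>f. \<not> is_permutation_mod f m \<and> real (num_values_mod f m) \<ge> m_of_prime m p"
proof -
  define r where "r = multiplicity p m"
  have p: "prime p" "r \<ge> 1" and m: "m > 0"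
    using assms by (auto simp: r_def prime_factors_multiplicity intro!: Nat.gr0I)
  then obtain n where n: "m = p ^ r * n" "\<not> p dvd n"
    unfolding r_def using multiplicity_decompose'[of m p]
    by (metis not_prime_unit neq0_conv)
  have pos: "n > 0" "p ^ r > 0"
    using m n(1) by simp_all
  have cop: "coprime (p ^ r) n"
    using p(1) n(2) by (simp add: prime_imp_coprime)
  obtain g where g: "\<not> is_permutation_mod g (p ^ r)" "num_values_mod g (p ^ r) \<ge> prime_power_max p r"
    using exists_polynomial_prime_power_max[OF p] by blast
  obtain u v where uv: "u * int (p ^ r) + v * int n = 1"
    using bezout_int[of "int (p ^ r)" "int n"] cop
    by (metis coprime_imp_gcd_eq_1 coprime_int_iff)
  \<comment> \<open>By Bezout, \<open>v * n\<close> is 1 modulo \<open>p ^ r\<close> and 0 modulo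
    \<open>n\<close>, and \<open>u * p ^ r\<close> the reverse.\<close>
  define f :: "int poly" where "f = smult (v * int n) g + smult (u * int (p ^ r)) [:0, 1:]"
  have "poly f x - poly g x = int (p ^ r) * (u * (x - poly g x))" for x
  proof -
    have "v * int n = 1 - u * int (p ^ r)"
      using uv by simp
    then show ?thesis
      unfolding f_def by (simp only: poly_add poly_smult poly_pCons poly_0) (simp add: algebra_simps)
  qed
  then have "[poly f x = poly g x] (mod int (p ^ r))" for x
    by (simp add: cong_iff_dvd_diff)
  then have Npr: "num_values_mod f (p ^ r) = num_values_mod g (p ^ r)"
    by (rule num_values_mod_cong)
  have "poly f x - x = int n * (v * (poly g x - x))" for x
  proof -
    have "u * int (p ^ r) = 1 - v * int n"
      using uv by simp
    then show ?thesis
      unfolding f_def by (simp only: poly_add poly_smult poly_pCons poly_0) (simp add: algebra_simps)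
  qed
  then have "[poly f x = poly [:0, 1:] x] (mod int n)" for x
    by (simp add: cong_iff_dvd_diff)
  then have "num_values_mod f n = num_values_mod [:0, 1:] n"
    by (rule num_values_mod_cong)
  moreover have "is_permutation_mod [:0, 1:] n"
    using pos by (simp add: is_permutation_mod_iff_cong)
  ultimately have Nn: "num_values_mod f n = n"
    using is_permutation_mod_iff_num_values[OF pos(1), of "[:0, 1:]"] by simp
  have "prime_power_max p r * n \<le> num_values_mod f (p ^ r) * num_values_mod f n"
    unfolding Npr Nn using g(2) by simp
  also have "\<dots> \<le> num_values_mod f m"
    unfolding n(1) by (rule num_values_mod_mult_coprime[OF pos(2,1) cop])
  finally have "m_of_prime m p \<le> real (num_values_mod f m)"
    unfolding n(1) m_of_prime_eq_prime_power_max[OF p n(2)] of_nat_le_iff .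
  moreover have "\<not> is_permutation_mod f m"
  proof -
    have "num_values_mod g (p ^ r) < p ^ r"
      using g(1) pos num_values_mod_le[of "p ^ r" g] is_permutation_mod_iff_num_values[of "p ^ r" g]
      by linarith
    then have "num_values_mod f (p ^ r) * n < m"
      unfolding Npr n(1) using pos by simp
    then have "num_values_mod f m < m"
      using num_values_mod_mult_le[OF pos(2,1), of f] by (simp only: flip: n(1))
    then show ?thesis
      using m by (simp add: is_permutation_mod_iff_num_values)
  qed
  ultimately show ?thesis by blast
qed

lemma max_values_mod_eq_Max:
  assumes "m \<ge> 2"
  shows "real (max_values_mod m) = Max (m_of_prime m ` prime_factors m)"
proof (rule antisym)
  let ?S = "{num_values_mod f m | f. \<not> is_permutation_mod f m}"
  have S: "finite ?S" "?S \<noteq> {}"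
    using assms finite_num_values_mod nonempty_num_values_mod by auto
  from Max_in[OF S] obtain f where f: "\<not> is_permutation_mod f m" "max_values_mod m = num_values_mod f m"
    unfolding max_values_mod_def by blast
  then obtain p where "p \<in> prime_factors m" "real (num_values_mod f m) \<le> m_of_prime m p"
    using num_values_mod_le_m_of_prime[of m f] assms by auto
  then show "real (max_values_mod m) \<le> Max (m_of_prime m ` prime_factors m)"
    unfolding f(2) by (meson Max_ge finite_imageI finite_set_mset imageI order_trans)
  have "prime_factors m \<noteq> {}"
    using assms by (auto simp: prime_factorization_empty_iff)
  moreover have "m_of_prime m p \<le> real (max_values_mod m)" if p: "p \<in> prime_factors m" for p
  proof -
    obtain f where f: "\<not> is_permutation_mod f m" "real (num_values_mod f m) \<ge> m_of_prime m p"
      using exists_polynomial_m_of_prime[OF p] by blast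
    then have "num_values_mod f m \<le> max_values_mod m"
      unfolding max_values_mod_def by (intro Max_ge S) blast
    with f(2) show ?thesis by linarith
  qed
  ultimately show "Max (m_of_prime m ` prime_factors m) \<le> real (max_values_mod m)"
    by auto
qed

section \<open>Comparison of \<open>m(p)\<close> over the prime factors\<close>

lemma m_of_prime_ge: "m_of_prime m p \<ge> real m * (1 - 1 / real p)"
  by (auto simp: m_of_prime_def intro!: mult_left_mono)

lemma m_of_prime_le: "m_of_prime m p \<le> real m * (1 - 1 / real p + 1 / (real p)\<^sup>2)"
  by (auto simp: m_of_prime_def intro!: mult_left_mono)

text \<open>The worst case sets the larger formula at \<open>p\<close> against the smaller one at
  \<open>q\<close>. It reduces to \<open>p\<^sup>2 \<le> q * (p - 1)\<close>, and
  \<open>(p + 2) * (p - 1)\<close> exceeds \<open>p\<^sup>2\<close> by \<open>p - 2\<close>.\<close>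

lemma m_of_prime_mono:
  assumes "p \<ge> 2" "q \<ge> p + 2"
  shows "m_of_prime m p \<le> m_of_prime m q"
proof -
  have "real q * (real p - 1) \<ge> (real p + 2) * (real p - 1)"
    using assms by (intro mult_right_mono) auto
  moreover have "(real p + 2) * (real p - 1) = (real p)\<^sup>2 + (real p - 2)"
    by (simp add: algebra_simps power2_eq_square)
  ultimately have "(real p)\<^sup>2 \<le> real q * (real p - 1)"
    using assms(1) by simp
  then have "1 / real q \<le> (real p - 1) / (real p)\<^sup>2"
    using assms by (simp add: field_simps)
  also have "\<dots> = 1 / real p - 1 / (real p)\<^sup>2"
    using assms(1) by (simp add: field_simps power2_eq_square)
  finally have "real m * (1 - 1 / real p + 1 / (real p)\<^sup>2) \<le> real m * (1 - 1 / real q)"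
    by (intro mult_left_mono) auto
  with m_of_prime_le[of m p] m_of_prime_ge[of m q] show ?thesis
    by linarith
qed

theorem theorem4p1:
  fixes m k p :: nat and q r :: "nat \<Rightarrow> nat"
  assumes "k \<ge> 1"
    and "\<And>i. i < k \<Longrightarrow> prime (q i)"
    and "inj_on q {..<k}"
    and "\<And>i. i < k \<Longrightarrow> r i \<ge> 1"
    and "m = (\<Prod>i<k. q i ^ r i)"
    and "p = Max (prime_factors m)"
  shows "((\<nexists>s. s \<ge> 2 \<and> m = 2 ^ s * 3) \<longrightarrow> real (max_values_mod m) = m_of_prime m p) \<and>
         (\<forall>s. s \<ge> 2 \<and> m = 2 ^ s * 3 \<longrightarrow> max_values_mod m = 2 ^ (s - 2) * 3\<^sup>2)"
proof (intro conjI impI allI)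
  have "m > 0"
    using assms(2,5) by (auto intro!: prod_pos simp: prime_gt_0_nat)
  have "q 0 dvd q 0 ^ r 0"
    using assms(1) assms(4)[of 0] by simp
  also have "q 0 ^ r 0 dvd m"
    unfolding assms(5) using assms(1) by (intro dvd_prodI) auto
  finally have "q 0 \<le> m"
    using \<open>m > 0\<close> by (rule dvd_imp_le)
  with assms(1) assms(2)[of 0] have m: "m \<ge> 2"
    using prime_ge_2_nat[of "q 0"] by linarith
  have ne: "prime_factors m \<noteq> {}"
    using m by (auto simp: prime_factorization_empty_iff)
  have p: "p \<in> prime_factors m" and p_max: "\<And>p'. p' \<in> prime_factors m \<Longrightarrow> p' \<le> p"
    unfolding assms(6) using ne by (auto intro: Max_in)
  {
    assume nex: "\<nexists>s. s \<ge> 2 \<and> m = 2 ^ s * 3"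
    have "m_of_prime m p' \<le> m_of_prime m p" if p': "p' \<in> prime_factors m" for p'
    proof -
      have primes: "prime p'" "prime p"
        using p p' by auto
      have "p' \<le> p"
        by (rule p_max[OF p'])
      \<comment> \<open>Only a gap of 1 escapes the comparison lemma, and parity then forces the
        primes 2 and 3.\<close>
      then consider "p' = p" | "p \<ge> p' + 2" | "p = p' + 1"
        by linarith
      then show ?thesis
      proof cases
        case 2
        with primes show ?thesis
          by (intro m_of_prime_mono) (auto simp: prime_ge_2_nat)
      next
        case 3
        then have "even p' \<or> even p" by auto
        then have p'2: "p' = 2" and p3: "p = 3"
          using 3 primes prime_ge_2_nat[of p'] primes_dvd_imp_eq[of 2 p'] primes_dvd_imp_eq[of 2 p]
          by auto
        have "prime_factors m = {2, 3}"
        proof -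
          have "x = 2 \<or> x = 3" if "x \<in> prime_factors m" for x
            using p_max[OF that] prime_ge_2_nat[OF in_prime_factors_imp_prime[OF that]] p3 by auto
          then show ?thesis
            using p p' p'2 p3 by auto
        qed
        then have m_eq: "m = 2 ^ multiplicity 2 m * 3 ^ multiplicity 3 m"
          using prime_factorization_nat[OF \<open>m > 0\<close>] by simp
        have "multiplicity 2 m \<ge> 1"
          using p' p'2 by (simp add: prime_factors_multiplicity)
        show ?thesis
        \<comment> \<open>The ratio \<open>m(2) / m\<close> is 1/2 or 3/4, and
          \<open>m(3) / m\<close> is 2/3 or 7/9. The prime 2 wins only with 3/4 against 2/3, which
          is the excluded family.\<close>
        proof (cases "multiplicity 3 m = 1")
          case True
          then have "\<not> multiplicity 2 m \<ge> 2"
            using nex m_eq by (metis power_one_right)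
          then have "multiplicity 2 m = 1"
            using \<open>multiplicity 2 m \<ge> 1\<close> by simp
          with True show ?thesis
            by (simp add: p'2 p3 m_of_prime_def)
        next
          case False
          then show ?thesis
            using m_of_prime_le[of m 2] by (simp add: p'2 p3 m_of_prime_def power2_eq_square)
        qed
      qed simp
    qed
    then show "real (max_values_mod m) = m_of_prime m p"
      unfolding max_values_mod_eq_Max[OF m] using p by (intro Max_eqI) auto
  }
  {
    fix s assume s: "s \<ge> 2 \<and> m = 2 ^ s * 3"
    have prime_3: "prime (3 :: nat)" by simp
    have pf: "prime_factors m = {2, 3}"
      using s primes_dvd_imp_eq[OF _ two_is_prime_nat] primes_dvd_imp_eq[OF _ prime_3]
        prime_dvd_power[of _ "2 :: nat" s]
      by (auto simp: prime_factors_dvd prime_dvd_mult_iff)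
    have "multiplicity 2 m = s" "multiplicity 3 m = 1"
      using s prime_dvd_power[OF prime_3, of 2 s] by (auto intro!: multiplicity_eqI)
    \<comment> \<open>Here 3/4 and 2/3 of \<open>2 ^ s * 3\<close> are compared, with
      \<open>2 ^ (s - 2)\<close> factored out.\<close>
    then have "m_of_prime m 2 = 2 ^ (s - 2) * 9" "m_of_prime m 3 = 2 ^ (s - 2) * 8"
      using s unfolding m_of_prime_def
      by (simp_all add: power2_eq_square power_eq_square_mult[of s "2 :: real"])
    then have "real (max_values_mod m) = 2 ^ (s - 2) * 9"
      unfolding max_values_mod_eq_Max[OF m] pf by simp
    then have "real (max_values_mod m) = real (2 ^ (s - 2) * 3\<^sup>2)"
      by simp
    then show "max_values_mod m = 2 ^ (s - 2) * 3\<^sup>2"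
      by (simp only: of_nat_eq_iff)
  }
qed

end
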